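(* There exists a chaotic hybrid system $X\in\mathfrak{X}_2$.
   Context: Let $\Sigma=\{(x,y)\in\mathbb{R}^2: x=0\}$, $A_1=\{x<0\}$, $A_2=\{x>0\}$. Points $(0,y)\in\Sigma$ are identified with $y\in\mathbb{R}$, and maps $\Sigma\to\Sigma$ with maps $\mathbb{R}\to\mathbb{R}$. For $n\geqslant 1$, $\mathfrak{X}_n$ is the class of hybrid systems $X=(X_1,X_2;\Sigma;\varphi)$ where, for $i\in\{1,2\}$, $X_i$ is a (possibly non-homogeneous, i.e. affine) linear vector field on $\mathbb{R}^2$, considered on $\overline{A_i}$, having a center singularity somewhere in $\mathbb{R}^2$ (so its non-constant orbits are ellipses around the center), and $\varphi:\Sigma\to\Sigma$ (the reset map) is a real polynomial of degree exactly $n$. Orbits. For $i\in\{1,2\}$ write $X_i$ enters $A_i$ at $p\in\Sigma$ if the solution of $X_i$ starting at $p$ lies in $A_i$ for all sufficiently small positive times. The global orbit of $X$ through $q$ is an ordered sequence of pieces $\Gamma(q,k,\cdot):[0,t_k]\to\mathbb{R}^2$, $k=1,2,\dots$, $t_k\geqslant 0$, defined as follows. - If $q\in A_i$: $\Gamma(q,1,t)$ is the solution of $X_i$ with initial condition $q$, followed until the first time $t_1>0$ at which it meets $\Sigma$. If it never meets $\Sigma$, it is followed for all $t\geqslant0$ and it is the whole orbit. - Whenever a piece governed by $X_i$ ends at a point $p\in\Sigma$, the orbit jumps to $p'=\varphi(p)$, which is the starting point of the next piece, governed by the other field $X_{i'}$, $i'\neq i$. If $X_{i'}$ enters $A_{i'}$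 at $p'$, the next piece is the solution of $X_{i'}$ from $p'$ until it first returns to $\Sigma$ at a positive time; otherwise the next piece is the single point $p'$ (duration $0$), and it ends at $p'$. - If $q\in\Sigma$ there are two orbits $\Gamma_1(q,\cdot,\cdot)$ and $\Gamma_2(q,\cdot,\cdot)$: for $\Gamma_i$ the first piece starts at $q$ and is governed by $X_i$ (it is the solution of $X_i$ from $q$ until its first return to $\Sigma$ if $X_i$ enters $A_i$ at $q$, and the single point $q$ otherwise), and then one continues by the rule above. - If $q\notin\Sigma$ the orbit is unique and $\Gamma_1=\Gamma_2=\Gamma$. First return map $P:\Sigma\to\Sigma$: for $y\in\Sigma$, $P(y)$ is the starting point of the third piece of $\Gamma_1(y,\cdot,\cdot)$ (i.e. after one piece governed by $X_1$, a jump, one piece governed by $X_2$, and a jump). The orbit $\Gamma_1(y,\cdot,\cdot)$, $y\in\Sigma$, is periodic if $P^m(y)=y$ for some $m\geqslant1$. A set $K\subset\mathbb{R}^2$ is positive invariant by $X$ if for every $q\in K$ we have $\Gamma_i(q,j,t)\in K$ for all $i\in\{1,2\}$, all $j\in\mathbb{N}$ and all $t\geqslant0$ for which it is defined. $B_\varepsilon(q)$ is the open ball of radius $\varepsilon$ centered at $q$, and $\|\cdot\|$ is the Euclidean norm. Definition of chaotic. $X\in\mathfrak{X}_n$ is chaotic if there is a positive invariant compact set $K\subset\mathbb{R}^2$ such that: (i) the periodic orbits of $X$ are dense in $K$ (the set of points of $K$ lying on periodic orbits is dense in $K$); (ii) given any two nonempty (relatively) open sets $U_1,U_2\subset K$,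 there are $q\in U_1$, $j_0\in\mathbb{N}$ and $t_0>0$ such that $\Gamma_i(q,j_0,t_0)\in U_2$ for some $i\in\{1,2\}$; (iii) there is $\beta>0$ such that for every $q_1\in K$ and $\varepsilon>0$ there are $q_2\in B_\varepsilon(q_1)\cap K$, $j_0\in\mathbb{N}$, $t_0>0$ and $i_0\in\{1,2\}$ such that $\|\Gamma_{i_0}(q_1,j_0,t_0)-\Gamma_{i_0}(q_2,j_0,t_0)\|>\beta$ (both being defined). *)

theory Defs
  imports "HOL-Analysis.Analysis" "HOL-Computational_Algebra.Polynomial"
begin

type_synonym plane = "real \<times> real"

datatype side = S1 | S2

primrec other :: "side \<Rightarrow> side" where
  "other S1 = S2"
| "other S2 = S1"

primrec zone :: "side \<Rightarrow> plane set" where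
  "zone S1 = {p. fst p < 0}"
| "zone S2 = {p. fst p > 0}"

definition Sigma_line :: "plane set" where
  "Sigma_line = {p. fst p = 0}"

definition affine_field :: "(plane \<Rightarrow> plane) \<Rightarrow> bool" where
  "affine_field F \<longleftrightarrow> (\<exists>L b. linear L \<and> F = (\<lambda>v. L v + b))"

definition is_solution :: "(plane \<Rightarrow> plane) \<Rightarrow> (real \<Rightarrow> plane) \<Rightarrow> bool" where
  "is_solution F u \<longleftrightarrow> (\<forall>t. (u has_vector_derivative F (u t)) (at t))"

text \<open>The flow is only used for affine fields, for which the solution of every initial value
  problem exists on the whole real line and is unique.\<close>

definition flow :: "(plane \<Rightarrow> plane) \<Rightarrow> plane \<Rightarrow> real \<Rightarrow> plane" where
  "flow F q = (THE u. u 0 = q \<and> is_solution F u)"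

text \<open>A center is a singularity with a punctured neighbourhood filled with nonconstant
  periodic orbits.\<close>

definition is_center :: "(plane \<Rightarrow> plane) \<Rightarrow> plane \<Rightarrow> bool" where
  "is_center F p \<longleftrightarrow> F p = 0 \<and>
     (\<exists>U. open U \<and> p \<in> U \<and>
       (\<forall>q\<in>U - {p}. F q \<noteq> 0 \<and> (\<exists>T>0. \<forall>t. flow F q (t + T) = flow F q t)))"

text \<open>The reset map acts on the line \<open>x = 0\<close>, whose points \<open>(0, y)\<close> are identified with \<open>y\<close>.\<close>

record hybrid_system =
  vfield :: "side \<Rightarrow> plane \<Rightarrow> plane"
  reset :: "real \<Rightarrow> real"

definition hybrid_class :: "nat \<Rightarrow> hybrid_system set" where
  "hybrid_class n =
     {X. (\<forall>i. affine_field (vfield X i) \<and> (\<exists>p. is_center (vfield X i) p)) \<and>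
         (\<exists>f :: real poly. degree f = n \<and> reset X = poly f)}"

definition enters :: "hybrid_system \<Rightarrow> side \<Rightarrow> plane \<Rightarrow> bool" where
  "enters X i p \<longleftrightarrow>
     (\<exists>\<epsilon>>0. \<forall>t. 0 < t \<and> t < \<epsilon> \<longrightarrow> flow (vfield X i) p t \<in> zone i)"

definition first_hit :: "hybrid_system \<Rightarrow> side \<Rightarrow> plane \<Rightarrow> real \<Rightarrow> bool" where
  "first_hit X i p T \<longleftrightarrow> 0 < T \<and> flow (vfield X i) p T \<in> Sigma_line \<and>
     (\<forall>t. 0 < t \<and> t < T \<longrightarrow> flow (vfield X i) p t \<notin> Sigma_line)"

text \<open>Duration of the piece governed by field \<open>i\<close> that starts at \<open>p\<close>; \<open>None\<close> means that
  the solution is followed for all \<open>t \<ge> 0\<close>. It is applied only to points of \<open>zone i\<close> and of the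
  line \<open>x = 0\<close>.\<close>

definition duration :: "hybrid_system \<Rightarrow> side \<Rightarrow> plane \<Rightarrow> real option" where
  "duration X i p =
     (if p \<in> Sigma_line \<and> \<not> enters X i p then Some 0
      else if \<exists>T. first_hit X i p T then Some (THE T. first_hit X i p T)
      else None)"

text \<open>\<open>piece X i q k\<close> is the governing field and the starting point of piece number \<open>k\<close> of the
  orbit \<open>\<Gamma>\<^sub>i\<close> through \<open>q\<close>, or \<open>None\<close> if the orbit has no such piece. Pieces are numbered from
  \<open>0\<close>. The index \<open>i\<close> matters only if \<open>q\<close> lies on the line \<open>x = 0\<close>.\<close>

primrec piece :: "hybrid_system \<Rightarrow> side \<Rightarrow> plane \<Rightarrow> nat \<Rightarrow> (side \<times> plane) option" where
  "piece X i q 0 =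
     Some (if q \<in> zone S1 then S1 else if q \<in> zone S2 then S2 else i, q)"
| "piece X i q (Suc k) =
     (case piece X i q k of
        None \<Rightarrow> None
      | Some (j, p) \<Rightarrow>
          (case duration X j p of
             None \<Rightarrow> None
           | Some T \<Rightarrow> Some (other j, (0, reset X (snd (flow (vfield X j) p T))))))"

definition Gam :: "hybrid_system \<Rightarrow> side \<Rightarrow> plane \<Rightarrow> nat \<Rightarrow> real \<Rightarrow> plane option" where
  "Gam X i q k t =
     (case piece X i q k of
        None \<Rightarrow> None
      | Some (j, p) \<Rightarrow>
          if 0 \<le> t \<and> (\<forall>T. duration X j p = Some T \<longrightarrow> t \<le> T)
          then Some (flow (vfield X j) p t) else None)"

text \<open>For systems in \<open>hybrid_class n\<close> every solution that enters a zone from the line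
  \<open>x = 0\<close> returns to that line, so the third piece, which has number \<open>2\<close>, always exists.\<close>

definition return_map :: "hybrid_system \<Rightarrow> real \<Rightarrow> real" where
  "return_map X y = snd (snd (the (piece X S1 (0, y) 2)))"

definition periodic_orbit :: "hybrid_system \<Rightarrow> real \<Rightarrow> bool" where
  "periodic_orbit X y \<longleftrightarrow> (\<exists>m\<ge>1. (return_map X ^^ m) y = y)"

definition periodic_points :: "hybrid_system \<Rightarrow> plane set" where
  "periodic_points X =
     {z. \<exists>y k t. periodic_orbit X y \<and> Gam X S1 (0, y) k t = Some z}"

definition positive_invariant :: "hybrid_system \<Rightarrow> plane set \<Rightarrow> bool" where
  "positive_invariant X K \<longleftrightarrow>
     (\<forall>q\<in>K. \<forall>i j t z. Gam X i q j t = Some z \<longrightarrow> z \<in> K)"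

text \<open>\<open>K\<close> has to be nonempty: the empty set satisfies all the other conditions vacuously.\<close>

definition chaotic :: "hybrid_system \<Rightarrow> bool" where
  "chaotic X \<longleftrightarrow>
     (\<exists>K. K \<noteq> {} \<and> compact K \<and> positive_invariant X K \<and>
       K \<subseteq> closure (periodic_points X \<inter> K) \<and>
       (\<forall>U1 U2. openin (top_of_set K) U1 \<and> U1 \<noteq> {} \<and> openin (top_of_set K) U2 \<and> U2 \<noteq> {} \<longrightarrow>
          (\<exists>q\<in>U1. \<exists>j0 t0 i. 0 < t0 \<and> (\<exists>z\<in>U2. Gam X i q j0 t0 = Some z))) \<and>
       (\<exists>\<beta>>0. \<forall>q1\<in>K. \<forall>\<epsilon>>0.
          \<exists>q2\<in>ball q1 \<epsilon> \<inter> K. \<exists>j0 t0 i0 z1 z2. 0 < t0 \<and>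
            Gam X i0 q1 j0 t0 = Some z1 \<and> Gam X i0 q2 j0 t0 = Some z2 \<and>
            norm (z1 - z2) > \<beta>))"

end

theory Submission
  imports Defs
begin

text \<open>
  The example is built so that, in the annulus \<open>K\<close> of radii from \<open>1\<close> to \<open>5\<close>, every piece of an
  orbit after the first one is a half circle, and the radii of these half circles are the iterates
  of the quadratic map \<open>y \<mapsto> (y - 3)\<^sup>2 + 1\<close> on \<open>[1, 5]\<close>, which is conjugate to the Chebyshev map
  \<open>x \<mapsto> x\<^sup>2 - 2\<close> on \<open>[-2, 2]\<close> and therefore chaotic.

  In the left half plane the field is the counterclockwise rotation about the origin, in the right
  half plane the clockwise one. Both fields enter their zone exactly at the points \<open>(0, y)\<close> with
  \<open>y > 0\<close>, and such a piece ends at \<open>(0, -y)\<close> after time \<open>\<pi>\<close>. With the reset map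
  \<open>y \<mapsto> (y + 3)\<^sup>2 + 1\<close> the next piece starts at \<open>(y - 3)\<^sup>2 + 1\<close>. This map preserves the interval
  \<open>[1, 5]\<close>, which consists of positive numbers; so every jump
  from \<open>K\<close> lands at a point of \<open>K\<close> where the next field enters its zone, and \<open>K\<close> is positive
  invariant.

  In the coordinate \<open>y = 3 + 2 cos \<theta>\<close> the map is the doubling \<open>\<theta> \<mapsto> 2 \<theta>\<close>. Hence its periodic
  points are dense (\<open>quad_periodic_dense\<close>), and the \<open>n\<close>-th iterate maps any small interval onto the
  whole of \<open>[1, 5]\<close> as soon as \<open>n\<close> is large (\<open>quad_locally_onto\<close>). The first fact gives the density
  of periodic orbits. The second gives transitivity, because the freedom in \<open>n\<close> allows one to arrive
  in the prescribed half plane, and it gives sensitivity, because a nearby radius can be sent to the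
  end of \<open>[1, 5]\<close> that is farther from the iterate of the given radius.
\<close>

section \<open>The quadratic map\<close>

definition quad_map :: "real \<Rightarrow> real" where
  "quad_map y = (y - 3)\<^sup>2 + 1"

text \<open>The double angle formula \<open>cos (2 \<theta>) = 2 (cos \<theta>)\<^sup>2 - 1\<close> turns the quadratic map into angle
  doubling.\<close>

lemma quad_map_funpow_cos:
  "(quad_map ^^ n) (3 + 2 * cos \<theta>) = 3 + 2 * cos (2 ^ n * \<theta>)"
proof (induction n)
  case (Suc n)
  have "(quad_map ^^ Suc n) (3 + 2 * cos \<theta>) = quad_map (3 + 2 * cos (2 ^ n * \<theta>))"
    using Suc by simp
  also have "\<dots> = 3 + 2 * cos (2 * (2 ^ n * \<theta>))"
    by (subst cos_double_cos) (simp add: quad_map_def power2_eq_square)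
  finally show ?case
    by (simp add: mult.assoc)
qed simp

lemma cos_coordinate:
  fixes r :: real
  assumes "r \<in> {1..5}"
  obtains \<theta> where "r = 3 + 2 * cos \<theta>"
proof -
  have "cos (arccos ((r - 3) / 2)) = (r - 3) / 2"
    using assms by (intro cos_arccos) auto
  then show ?thesis
    using that[of "arccos ((r - 3) / 2)"] by simp
qed

lemma cos_coordinate_range: "3 + 2 * cos \<theta> \<in> {1..5 :: real}"
  unfolding atLeastAtMost_iff
  using cos_le_one[of \<theta>] cos_ge_minus_one[of \<theta>] by (intro conjI) linarith+

lemma quad_map_funpow_range:
  assumes "r \<in> {1..5}"
  shows "(quad_map ^^ n) r \<in> {1..5}"
proof -
  obtain \<theta> where "r = 3 + 2 * cos \<theta>"
    using assms by (rule cos_coordinate)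
  then show ?thesis
    using cos_coordinate_range[of "2 ^ n * \<theta>"] by (simp add: quad_map_funpow_cos)
qed

lemma abs_cos_diff_le: "\<bar>cos x - cos y\<bar> \<le> \<bar>x - y :: real\<bar>"
proof -
  have "\<bar>cos x - cos y\<bar> = 2 * (\<bar>sin ((x + y) / 2)\<bar> * \<bar>sin ((y - x) / 2)\<bar>)"
    by (simp add: cos_diff_cos abs_mult)
  also have "\<dots> \<le> 2 * (1 * \<bar>(y - x) / 2\<bar>)"
    by (intro mult_left_mono mult_mono abs_sin_x_le_abs_x abs_sin_le_one) auto
  finally show ?thesis
    by simp
qed

text \<open>The points \<open>(\<sigma> + 2 \<pi> m) / c\<close>, with \<open>m\<close> an integer, have distance \<open>2 \<pi> / c\<close> from one
  another; they are the preimages of \<open>\<sigma>\<close> modulo \<open>2 \<pi>\<close> under multiplication by \<open>c\<close>.\<close>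

lemma lattice_point_near:
  fixes \<theta> \<sigma> c :: real
  assumes "c > 0"
  obtains m :: int where "\<bar>(\<sigma> + 2 * pi * m) / c - \<theta>\<bar> \<le> 2 * pi / c"
proof -
  define m where "m = \<lfloor>(c * \<theta> - \<sigma>) / (2 * pi)\<rfloor>"
  have "of_int m \<le> (c * \<theta> - \<sigma>) / (2 * pi)" "(c * \<theta> - \<sigma>) / (2 * pi) < of_int m + 1"
    unfolding m_def by linarith+
  then have "of_int m * (2 * pi) \<le> c * \<theta> - \<sigma>" "c * \<theta> - \<sigma> < (of_int m + 1) * (2 * pi)"
    by (simp_all add: field_simps)
  then have "\<bar>(\<sigma> + 2 * pi * m) - c * \<theta>\<bar> \<le> 2 * pi"
    by (simp add: algebra_simps abs_le_iff)
  then have "\<bar>(\<sigma> + 2 * pi * m) - c * \<theta>\<bar> / c \<le> 2 * pi / c"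
    using assms by (intro divide_right_mono) auto
  moreover have "\<bar>(\<sigma> + 2 * pi * m) - c * \<theta>\<bar> / c = \<bar>(\<sigma> + 2 * pi * m) / c - \<theta>\<bar>"
  proof -
    have "(\<sigma> + 2 * pi * m) / c - \<theta> = ((\<sigma> + 2 * pi * m) - c * \<theta>) / c"
      using assms by (simp add: diff_divide_distrib)
    then show ?thesis
      using assms by (simp add: abs_divide)
  qed
  ultimately show ?thesis
    using that by metis
qed

lemma cos_coordinate_near:
  fixes r c \<theta> \<theta>' :: real
  assumes "\<bar>\<theta>' - \<theta>\<bar> \<le> 2 * pi / c" "c > 4 * pi / \<epsilon>" "\<epsilon> > 0"
  shows "\<bar>(3 + 2 * cos \<theta>') - (3 + 2 * cos \<theta>)\<bar> < \<epsilon>"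
proof -
  have "c > 0"
    using assms by (smt (verit) divide_pos_pos pi_gt_zero)
  have "\<bar>(3 + 2 * cos \<theta>') - (3 + 2 * cos \<theta>)\<bar> \<le> 2 * \<bar>\<theta>' - \<theta>\<bar>"
    using abs_cos_diff_le[of \<theta>' \<theta>] by (smt (verit))
  also have "\<dots> \<le> 4 * pi / c"
    using assms(1) by simp
  also have "\<dots> < \<epsilon>"
    using assms \<open>c > 0\<close> by (simp add: field_simps)
  finally show ?thesis .
qed

text \<open>Every target has preimages under doubling iterated \<open>n\<close> times that are spaced by
  \<open>2 \<pi> / 2\<^sup>n\<close>.\<close>

lemma quad_locally_onto:
  assumes r: "r \<in> {1..5}" and "\<epsilon> > 0"
  shows "\<exists>N. \<forall>n\<ge>N. \<forall>s\<in>{1..5}. \<exists>r'\<in>{1..5}. \<bar>r' - r\<bar> < \<epsilon> \<and> (quad_map ^^ n) r' = s"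
proof -
  obtain \<theta> where \<theta>: "r = 3 + 2 * cos \<theta>"
    using r by (rule cos_coordinate)
  obtain N where N: "4 * pi / \<epsilon> < 2 ^ N"
    using real_arch_pow[of 2 "4 * pi / \<epsilon>"] by auto
  have "\<exists>r'\<in>{1..5}. \<bar>r' - r\<bar> < \<epsilon> \<and> (quad_map ^^ n) r' = s"
    if "n \<ge> N" and s: "s \<in> {1..5}" for n s
  proof -
    obtain \<sigma> where \<sigma>: "s = 3 + 2 * cos \<sigma>"
      using s by (rule cos_coordinate)
    have c: "4 * pi / \<epsilon> < 2 ^ n"
      using N power_increasing[OF \<open>n \<ge> N\<close>, of "2 :: real"] by linarith
    obtain m :: int where m: "\<bar>(\<sigma> + 2 * pi * m) / 2 ^ n - \<theta>\<bar> \<le> 2 * pi / 2 ^ n"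
      using lattice_point_near[of "2 ^ n" \<sigma> \<theta>] by auto
    define \<theta>' where "\<theta>' = (\<sigma> + 2 * pi * m) / 2 ^ n"
    have "2 ^ n * \<theta>' = \<sigma> + 2 * pi * m"
      by (simp add: \<theta>'_def)
    then have "cos (2 ^ n * \<theta>') = cos \<sigma>"
      by (simp add: cos_add cos_int_2pin sin_int_2pin)
    then have "(quad_map ^^ n) (3 + 2 * cos \<theta>') = s"
      by (simp add: quad_map_funpow_cos \<sigma>)
    moreover have "\<bar>(3 + 2 * cos \<theta>') - r\<bar> < \<epsilon>"
      unfolding \<theta> using m c \<open>\<epsilon> > 0\<close> unfolding \<theta>'_def[symmetric] by (rule cos_coordinate_near)
    ultimately show ?thesis
      using cos_coordinate_range by blast
  qed
  then show ?thesis
    by blast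
qed

text \<open>The multiples of \<open>2 \<pi> / (2\<^sup>n - 1)\<close> are fixed modulo \<open>2 \<pi>\<close> by doubling iterated \<open>n\<close> times.\<close>

lemma quad_periodic_dense:
  assumes r: "r \<in> {1..5}" and "\<epsilon> > 0"
  obtains r' n where "r' \<in> {1..5}" "\<bar>r' - r\<bar> < \<epsilon>" "n \<ge> 1" "(quad_map ^^ n) r' = r'"
proof -
  obtain \<theta> where \<theta>: "r = 3 + 2 * cos \<theta>"
    using r by (rule cos_coordinate)
  obtain n where n: "4 * pi / \<epsilon> + 1 < 2 ^ n"
    using real_arch_pow[of 2 "4 * pi / \<epsilon> + 1"] by auto
  define c :: real where "c = 2 ^ n - 1"
  have c: "c > 4 * pi / \<epsilon>" "c > 0"
    using n \<open>\<epsilon> > 0\<close> unfolding c_def by (smt (verit) divide_pos_pos pi_gt_zero)+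
  have "n \<ge> 1"
    using c(2) by (cases n) (auto simp: c_def)
  obtain m :: int where m: "\<bar>(0 + 2 * pi * m) / c - \<theta>\<bar> \<le> 2 * pi / c"
    using lattice_point_near[OF c(2)] .
  define \<theta>' where "\<theta>' = (0 + 2 * pi * m) / c"
  have "c * \<theta>' = 2 * pi * m"
    using c(2) by (simp add: \<theta>'_def)
  then have "2 ^ n * \<theta>' = \<theta>' + 2 * pi * m"
    by (simp add: c_def algebra_simps)
  then have "cos (2 ^ n * \<theta>') = cos \<theta>'"
    by (simp add: cos_add cos_int_2pin sin_int_2pin)
  then have "(quad_map ^^ n) (3 + 2 * cos \<theta>') = 3 + 2 * cos \<theta>'"
    by (simp add: quad_map_funpow_cos)
  moreover have "\<bar>(3 + 2 * cos \<theta>') - r\<bar> < \<epsilon>"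
    unfolding \<theta> using m c(1) \<open>\<epsilon> > 0\<close> unfolding \<theta>'_def[symmetric] by (rule cos_coordinate_near)
  ultimately show ?thesis
    using that cos_coordinate_range \<open>n \<ge> 1\<close> by blast
qed

section \<open>The rotation fields and their flows\<close>

text \<open>With this sign, \<open>zone i\<close> is the half plane where \<open>orient i * x < 0\<close>.\<close>

primrec orient :: "side \<Rightarrow> real" where
  "orient S1 = 1"
| "orient S2 = -1"

definition rot_field :: "side \<Rightarrow> plane \<Rightarrow> plane" where
  "rot_field i p = (- orient i * snd p, orient i * fst p)"

definition rot :: "side \<Rightarrow> real \<Rightarrow> plane \<Rightarrow> plane" where
  "rot i t p = (fst p * cos t - orient i * snd p * sin t, orient i * fst p * sin t + snd p * cos t)"

lemma orient_square_left [simp]: "orient i * (orient i * x) = x"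
  by (cases i) auto

lemma zone_iff: "p \<in> zone i \<longleftrightarrow> orient i * fst p < 0"
  by (cases i) auto

lemma is_solution_rot: "is_solution (rot_field i) (\<lambda>t. rot i t q)"
  unfolding is_solution_def
proof
  fix t
  have "((\<lambda>t. fst q * cos t - orient i * snd q * sin t) has_vector_derivative
          - orient i * snd (rot i t q)) (at t)"
    "((\<lambda>t. orient i * fst q * sin t + snd q * cos t) has_vector_derivative
          orient i * fst (rot i t q)) (at t)"
    unfolding rot_def has_real_derivative_iff_has_vector_derivative[symmetric]
    by (auto intro!: derivative_eq_intros simp: algebra_simps)
  from has_vector_derivative_Pair[OF this]
  show "((\<lambda>t. rot i t q) has_vector_derivative rot_field i (rot i t q)) (at t)"
    by (simp add: rot_def rot_field_def)
qed

text \<open>Uniqueness: turning a solution back by the rotation gives a curve with derivative zero.\<close>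

lemma solution_rot_unique:
  assumes "is_solution (rot_field i) u" "u 0 = q"
  shows "u t = rot i t q"
proof -
  define x y where "x = (\<lambda>t. fst (u t))" and "y = (\<lambda>t. snd (u t))"
  have u': "(u has_vector_derivative rot_field i (u t)) (at t)" for t
    using assms(1) by (simp add: is_solution_def)
  have x': "(x has_real_derivative - orient i * y t) (at t)" for t
    using bounded_linear.has_vector_derivative[OF bounded_linear_fst u'[of t]]
    by (simp add: x_def y_def rot_field_def has_real_derivative_iff_has_vector_derivative)
  have y': "(y has_real_derivative orient i * x t) (at t)" for t
    using bounded_linear.has_vector_derivative[OF bounded_linear_snd u'[of t]]
    by (simp add: x_def y_def rot_field_def has_real_derivative_iff_has_vector_derivative)
  define v w where "v = (\<lambda>t. x t * cos t + orient i * y t * sin t)"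
    and "w = (\<lambda>t. y t * cos t - orient i * x t * sin t)"
  have "(v has_real_derivative 0) (at t)" "(w has_real_derivative 0) (at t)" for t
    unfolding v_def w_def by (auto intro!: derivative_eq_intros x' y' simp: algebra_simps)
  then have vw: "v t = v 0" "w t = w 0"
    by (auto intro: DERIV_isconst_all)
  have "x t * (cos t * cos t + sin t * sin t) = v t * cos t - orient i * w t * sin t"
    by (simp add: v_def w_def algebra_simps del: sin_cos_squared_add3)
  moreover have "y t * (cos t * cos t + sin t * sin t) = orient i * v t * sin t + w t * cos t"
    by (simp add: v_def w_def algebra_simps del: sin_cos_squared_add3)
  moreover have "v 0 = fst q" "w 0 = snd q"
    by (simp_all add: v_def w_def x_def y_def assms(2))
  ultimately show ?thesis
    by (simp add: rot_def vw prod_eq_iff x_def y_def mult_ac)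
qed

lemma flow_rot_field: "flow (rot_field i) q = (\<lambda>t. rot i t q)"
  unfolding flow_def
proof (rule the_equality)
  show "rot i 0 q = q \<and> is_solution (rot_field i) (\<lambda>t. rot i t q)"
    by (simp add: is_solution_rot) (simp add: rot_def)
next
  fix u
  assume "u 0 = q \<and> is_solution (rot_field i) u"
  then show "u = (\<lambda>t. rot i t q)"
    using solution_rot_unique by blast
qed

lemma affine_rot_field: "affine_field (rot_field i)"
proof -
  have "linear (rot_field i)"
    by (rule linearI) (auto simp: rot_field_def algebra_simps)
  then show ?thesis
    unfolding affine_field_def by (intro exI[of _ "rot_field i"] exI[of _ 0]) auto
qed

lemma is_center_rot_field: "is_center (rot_field i) 0"
proof -
  have "rot_field i q \<noteq> 0" if "q \<noteq> 0" for q
    using that by (cases i) (auto simp: rot_field_def prod_eq_iff)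
  moreover have "flow (rot_field i) q (t + 2 * pi) = flow (rot_field i) q t" for q t
    by (simp add: flow_rot_field rot_def)
  ultimately show ?thesis
    unfolding is_center_def
    by (intro conjI exI[of _ UNIV]) (auto simp: rot_field_def zero_prod_def intro!: exI[of _ "2 * pi"])
qed

section \<open>The hybrid system and its orbits\<close>

definition rot_system :: hybrid_system where
  "rot_system = \<lparr>vfield = rot_field, reset = poly [:10, 6, 1:]\<rparr>"

lemma vfield_rot_system [simp]: "vfield rot_system = rot_field"
  by (simp add: rot_system_def)

lemma reset_rot_system: "reset rot_system (- r) = quad_map r"
  by (simp add: rot_system_def quad_map_def power2_eq_square algebra_simps)

lemma rot_system_in_class: "rot_system \<in> hybrid_class 2"
proof -
  have "degree [:10, 6, 1 :: real:] = 2"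
    by simp
  then show ?thesis
    using affine_rot_field is_center_rot_field
    unfolding hybrid_class_def rot_system_def by fastforce
qed

text \<open>Polar coordinates adapted to a side: \<open>polar i r\<close> is the orbit of field \<open>i\<close> that starts at
  \<open>(0, r)\<close>, so for \<open>r > 0\<close> it runs through \<open>zone i\<close> while the angle increases from \<open>0\<close> to \<open>\<pi>\<close>.\<close>

definition polar :: "side \<Rightarrow> real \<Rightarrow> real \<Rightarrow> plane" where
  "polar i r a = (- orient i * r * sin a, r * cos a)"

lemma rot_polar: "rot i t (polar i r a) = polar i r (a + t)"
  by (simp add: rot_def polar_def cos_add sin_add algebra_simps)

lemma polar_0 [simp]: "polar i r 0 = (0, r)"
  by (simp add: polar_def)

lemma polar_pi [simp]: "polar i r pi = (0, - r)"
  by (simp add: polar_def)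

lemma polar_diff: "polar i r a - polar i r' a = polar i (r - r') a"
  by (simp add: polar_def algebra_simps)

lemma norm_polar [simp]: "norm (polar i r a) = \<bar>r\<bar>"
proof -
  have "(orient i)\<^sup>2 = 1"
    by (cases i) auto
  then have "(- orient i * r * sin a)\<^sup>2 + (r * cos a)\<^sup>2 = r\<^sup>2 * ((sin a)\<^sup>2 + (cos a)\<^sup>2)"
    by (simp only: power_mult_distrib power2_minus distrib_left)
  then have "(- orient i * r * sin a)\<^sup>2 + (r * cos a)\<^sup>2 = r\<^sup>2"
    by simp
  then show ?thesis
    by (simp add: polar_def norm_Pair)
qed

lemma polar_in_zone_iff: "r > 0 \<Longrightarrow> polar i r a \<in> zone i \<longleftrightarrow> sin a > 0"
proof -
  assume "r > 0"
  have "orient i * fst (polar i r a) = - (r * sin a)"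
    by (cases i) (auto simp: polar_def)
  then show ?thesis
    using \<open>r > 0\<close> by (simp add: zone_iff zero_less_mult_iff)
qed

lemma polar_in_Sigma_iff: "r > 0 \<Longrightarrow> polar i r a \<in> Sigma_line \<longleftrightarrow> sin a = 0"
  by (cases i) (auto simp: polar_def Sigma_line_def)

text \<open>At the angle \<open>\<pi>\<close> the field leaves the zone, and the duration is zero by the rule for points
  where the field does not enter; the formula covers this case too.\<close>

lemma duration_polar:
  assumes r: "r > 0" and a: "0 \<le> a" "a \<le> pi"
  shows "duration rot_system i (polar i r a) = Some (pi - a)"
proof (cases "a = pi")
  case True
  have "\<not> enters rot_system i (polar i r a)"
  proof
    assume "enters rot_system i (polar i r a)"
    then obtain \<epsilon> where \<epsilon>: "\<epsilon> > 0" "\<And>t. 0 < t \<Longrightarrow> t < \<epsilon> \<Longrightarrow> sin (a + t) > 0"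
      unfolding enters_def by (auto simp: flow_rot_field rot_polar polar_in_zone_iff[OF r])
    define t where "t = min (\<epsilon> / 2) (pi / 2)"
    have t: "0 < t" "t < \<epsilon>" "t < pi"
      using \<epsilon>(1) pi_gt_zero unfolding t_def by linarith+
    then have "sin t > 0"
      by (intro sin_gt_zero)
    then show False
      using \<epsilon>(2)[OF t(1,2)] True by (simp add: sin_add)
  qed
  moreover have "polar i r a \<in> Sigma_line"
    unfolding polar_in_Sigma_iff[OF r] using True by simp
  ultimately show ?thesis
    using True by (simp add: duration_def)
next
  case False
  then have pos: "sin (a + t) > 0" if "0 < t" "t < pi - a" for t
    using a that by (intro sin_gt_zero) auto
  have enters: "enters rot_system i (polar i r a)"
    unfolding enters_def
    using False a pos
    by (intro exI[of _ "pi - a"]) (auto simp: flow_rot_field rot_polar polar_in_zone_iff[OF r])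
  have "(0, - r) \<in> Sigma_line"
    by (simp add: Sigma_line_def)
  moreover have "sin (a + t) \<noteq> 0" if "0 < t" "t < pi - a" for t
    using pos[OF that] by simp
  ultimately have hit: "first_hit rot_system i (polar i r a) (pi - a)"
    using False a by (simp add: first_hit_def flow_rot_field rot_polar polar_in_Sigma_iff[OF r])
  have "T = pi - a" if "first_hit rot_system i (polar i r a) T" for T
    using that hit unfolding first_hit_def by (meson linorder_neqE_linordered_idom)
  then show ?thesis
    unfolding duration_def using enters hit by (metis the_equality)
qed

text \<open>The symbolic form of an orbit in the annulus: the sides alternate, the radii are iterates of
  the quadratic map, and every piece except the first starts at the angle \<open>0\<close>.\<close>

lemma piece_polar:
  assumes r: "r \<in> {1..5}" and a: "0 \<le> a" "a \<le> pi"
  shows "piece rot_system i (polar i r a) k =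
    Some ((other ^^ k) i, polar ((other ^^ k) i) ((quad_map ^^ k) r) (if k = 0 then a else 0))"
proof (induction k)
  case 0
  have "polar i r a \<notin> zone (other i)"
    using r sin_ge_zero[OF a] by (cases i) (auto simp: polar_def mult_nonneg_nonneg not_less)
  then show ?case
    by (cases i) auto
next
  case (Suc k)
  define j s b where "j = (other ^^ k) i" and "s = (quad_map ^^ k) r"
    and "b = (if k = 0 then a else 0)"
  have "s > 0"
    using quad_map_funpow_range[OF r, of k] by (simp add: s_def)
  moreover have b: "0 \<le> b" "b \<le> pi"
    using a by (auto simp: b_def)
  ultimately have "duration rot_system j (polar j s b) = Some (pi - b)"
    by (rule duration_polar)
  with Suc show ?case
    unfolding j_def[symmetric] s_def[symmetric] b_def[symmetric]
    by (simp add: flow_rot_field rot_polar reset_rot_system j_def[symmetric] s_def[symmetric])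
qed

lemma Gam_polar:
  assumes r: "r \<in> {1..5}" and a: "0 \<le> a" "a \<le> pi"
  shows "Gam rot_system i (polar i r a) k t =
    (let b = (if k = 0 then a else 0) in
     if 0 \<le> t \<and> t \<le> pi - b
     then Some (polar ((other ^^ k) i) ((quad_map ^^ k) r) (b + t)) else None)"
proof -
  define j s b where "j = (other ^^ k) i" and "s = (quad_map ^^ k) r"
    and "b = (if k = 0 then a else 0)"
  have "s > 0"
    using quad_map_funpow_range[OF r, of k] by (simp add: s_def)
  moreover have b: "0 \<le> b" "b \<le> pi"
    using a by (auto simp: b_def)
  ultimately have "duration rot_system j (polar j s b) = Some (pi - b)"
    by (rule duration_polar)
  then show ?thesis
    unfolding Gam_def piece_polar[OF assms]
    unfolding j_def[symmetric] s_def[symmetric] b_def[symmetric]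
    by (simp add: flow_rot_field rot_polar)
qed

lemma Gam_polar_Suc:
  assumes "r \<in> {1..5}" "0 \<le> a" "a \<le> pi" "0 \<le> t" "t \<le> pi" "k \<ge> 1"
  shows "Gam rot_system i (polar i r a) k t = Some (polar ((other ^^ k) i) ((quad_map ^^ k) r) t)"
  using assms by (simp add: Gam_polar)

lemma return_map_rot_system:
  assumes "r \<in> {1..5}"
  shows "return_map rot_system r = (quad_map ^^ 2) r"
  using piece_polar[OF assms, of 0 S1 2] by (simp add: return_map_def)

lemma return_map_funpow:
  assumes "r \<in> {1..5}"
  shows "(return_map rot_system ^^ m) r = (quad_map ^^ (2 * m)) r"
proof (induction m)
  case (Suc m)
  then show ?case
    using return_map_rot_system[OF quad_map_funpow_range[OF assms, of "2 * m"]]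
    by (simp add: eval_nat_numeral)
qed simp

section \<open>Chaos on the annulus\<close>

definition annulus :: "plane set" where
  "annulus = {p. 1 \<le> norm p \<and> norm p \<le> 5}"

lemma compact_annulus: "compact annulus"
proof -
  have "annulus = cball 0 5 - ball 0 1"
    by (auto simp: annulus_def)
  then show ?thesis
    using compact_diff[OF compact_cball open_ball] by metis
qed

lemma polar_in_annulus: "r \<in> {1..5} \<Longrightarrow> polar i r a \<in> annulus"
  by (simp add: annulus_def)

lemma polar_coordinates:
  assumes "orient i * fst q \<le> 0" "q \<noteq> 0"
  obtains a where "0 \<le> a" "a \<le> pi" "q = polar i (norm q) a"
proof -
  define r where "r = norm q"
  have "r > 0"
    using assms by (simp add: r_def)
  have r2: "r\<^sup>2 = (fst q)\<^sup>2 + (snd q)\<^sup>2"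
    by (simp add: r_def norm_prod_def)
  define c where "c = snd q / r"
  have "\<bar>snd q\<bar> \<le> r"
    unfolding r_def using norm_snd_le[of "snd q" "fst q"] by simp
  then have c: "-1 \<le> c" "c \<le> 1"
    using \<open>r > 0\<close> by (auto simp: c_def field_simps abs_le_iff)
  have "1 - c\<^sup>2 = (\<bar>fst q\<bar> / r)\<^sup>2"
  proof -
    have "1 - c\<^sup>2 = (r\<^sup>2 - (snd q)\<^sup>2) / r\<^sup>2"
      using \<open>r > 0\<close> by (simp add: c_def power_divide diff_divide_distrib)
    also have "r\<^sup>2 - (snd q)\<^sup>2 = (fst q)\<^sup>2"
      using r2 by simp
    finally show ?thesis
      by (simp add: power_divide)
  qed
  then have "r * sin (arccos c) = \<bar>fst q\<bar>"
    using \<open>r > 0\<close> c by (simp add: sin_arccos)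
  moreover have "- orient i * \<bar>fst q\<bar> = fst q"
    using assms(1) by (cases i) auto
  ultimately have "fst q = - orient i * r * sin (arccos c)"
    by (simp add: mult.assoc)
  moreover have "snd q = r * cos (arccos c)"
    using \<open>r > 0\<close> c by (simp add: c_def)
  ultimately have "q = polar i r (arccos c)"
    by (simp add: polar_def prod_eq_iff)
  then show ?thesis
    using that[of "arccos c"] arccos_lbound[OF c] arccos_ubound[OF c] by (simp add: r_def)
qed

text \<open>The side \<open>j\<close> differs from the given index \<open>i\<close> only if \<open>q\<close> lies in the zone of the other side,
  where the index does not influence the orbit.\<close>

lemma annulus_polar:
  assumes "q \<in> annulus"
  obtains j r a where "r \<in> {1..5}" "0 \<le> a" "a \<le> pi" "q = polar j r a"
    "Gam rot_system i q = Gam rot_system j q"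
proof -
  define j where "j = (if q \<in> zone S1 then S1 else if q \<in> zone S2 then S2 else i)"
  have "orient j * fst q \<le> 0"
    by (cases i) (auto simp: j_def)
  moreover have "q \<noteq> 0"
    using assms by (auto simp: annulus_def)
  ultimately obtain a where a: "0 \<le> a" "a \<le> pi" "q = polar j (norm q) a"
    by (rule polar_coordinates)
  have "piece rot_system i q k = piece rot_system j q k" for k
    by (induction k) (auto simp: j_def)
  then have "Gam rot_system i q = Gam rot_system j q"
    by (simp add: Gam_def fun_eq_iff)
  then show ?thesis
    using that a assms by (simp add: annulus_def)
qed

lemma positive_invariant_annulus: "positive_invariant rot_system annulus"
  unfolding positive_invariant_def
proof (intro ballI allI impI)
  fix q i k t z
  assume q: "q \<in> annulus" and G: "Gam rot_system i q k t = Some z"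
  obtain j r a where polar: "r \<in> {1..5}" "0 \<le> a" "a \<le> pi" "q = polar j r a"
      "Gam rot_system i q = Gam rot_system j q"
    using q by (rule annulus_polar)
  define s where "s = (quad_map ^^ k) r"
  have "s \<in> {1..5}"
    unfolding s_def using polar(1) by (rule quad_map_funpow_range)
  moreover have "\<exists>i b. z = polar i s b"
    using G Gam_polar[OF polar(1-3), of j k t] polar(4,5)
    by (auto simp: Let_def s_def split: if_splits)
  ultimately show "z \<in> annulus"
    using polar_in_annulus by metis
qed

text \<open>In the left zone the orbit through \<open>(0, r)\<close> itself passes through the polar; in the right zone
  \<open>(0, r)\<close> is the start of the second piece of the orbit of its predecessor in the cycle.\<close>

lemma polar_periodic:
  assumes r: "r \<in> {1..5}" and a: "0 \<le> a" "a \<le> pi" and n: "n \<ge> 1" "(quad_map ^^ n) r = r"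
  shows "polar i r a \<in> periodic_points rot_system"
proof -
  have per: "periodic_orbit rot_system y" if "y \<in> {1..5}" "(quad_map ^^ n) y = y" for y
  proof -
    have "(quad_map ^^ (2 * n)) y = y"
      using that(2) by (simp add: mult_2 funpow_add)
    then show ?thesis
      unfolding periodic_orbit_def using n(1) return_map_funpow[OF that(1), of n] by auto
  qed
  show ?thesis
  proof (cases i)
    case S1
    have "Gam rot_system S1 (0, r) 0 a = Some (polar S1 r a)"
      using Gam_polar[OF r, of 0 S1 0 a] a by simp
    then show ?thesis
      unfolding periodic_points_def using per[OF r n(2)] S1 by blast
  next
    case S2
    define y where "y = (quad_map ^^ (n - 1)) r"
    have y: "y \<in> {1..5}"
      unfolding y_def using r by (rule quad_map_funpow_range)
    have "quad_map y = (quad_map ^^ Suc (n - 1)) r"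
      by (simp add: y_def)
    then have next_y: "quad_map y = r"
      using n by simp
    have "(quad_map ^^ n) y = (quad_map ^^ (n - 1)) ((quad_map ^^ n) r)"
      by (simp add: y_def funpow_add[symmetric] add.commute flip: comp_apply[of "quad_map ^^ _"])
    then have "(quad_map ^^ n) y = y"
      by (simp add: n(2) y_def)
    moreover have "Gam rot_system S1 (0, y) 1 a = Some (polar S2 r a)"
      using Gam_polar_Suc[OF y, of 0 a 1 S1] a next_y by simp
    ultimately show ?thesis
      unfolding periodic_points_def using per[OF y] S2 by blast
  qed
qed

lemma periodic_points_dense: "annulus \<subseteq> closure (periodic_points rot_system \<inter> annulus)"
proof
  fix q
  assume "q \<in> annulus"
  then obtain i r a where polar: "r \<in> {1..5}" "0 \<le> a" "a \<le> pi" "q = polar i r a"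
    using annulus_polar by metis
  show "q \<in> closure (periodic_points rot_system \<inter> annulus)"
    unfolding closure_approachable
  proof safe
    fix \<epsilon> :: real
    assume "\<epsilon> > 0"
    obtain r' n where r': "r' \<in> {1..5}" "\<bar>r' - r\<bar> < \<epsilon>" "n \<ge> 1" "(quad_map ^^ n) r' = r'"
      using polar(1) \<open>\<epsilon> > 0\<close> by (rule quad_periodic_dense)
    have "polar i r' a \<in> periodic_points rot_system \<inter> annulus"
      using polar_periodic[OF r'(1) polar(2,3) r'(3,4)] polar_in_annulus[OF r'(1)] by blast
    moreover have "dist (polar i r' a) q < \<epsilon>"
      using r'(2) by (simp add: polar(4) dist_norm polar_diff)
    ultimately show "\<exists>y\<in>periodic_points rot_system \<inter> annulus. dist y q < \<epsilon>"
      by blast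
  qed
qed

text \<open>Two consecutive large iterates reach the target radius, and one of the two arrives on the
  target side.\<close>

lemma polar_transitive:
  assumes r: "r \<in> {1..5}" and "\<epsilon> > 0" and s: "s \<in> {1..5}"
  obtains r' n where "r' \<in> {1..5}" "\<bar>r' - r\<bar> < \<epsilon>" "n \<ge> 1" "(quad_map ^^ n) r' = s"
    "(other ^^ n) i = j"
proof -
  obtain N where N: "\<forall>n\<ge>N. \<forall>s\<in>{1..5}. \<exists>r'\<in>{1..5}. \<bar>r' - r\<bar> < \<epsilon> \<and> (quad_map ^^ n) r' = s"
    using quad_locally_onto[OF r \<open>\<epsilon> > 0\<close>] by blast
  obtain n where n: "n \<ge> Suc N" "(other ^^ n) i = j"
  proof (cases "(other ^^ Suc N) i = j")
    case False
    then have "(other ^^ Suc (Suc N)) i = j"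
      by (cases "(other ^^ Suc N) i"; cases j) auto
    then show ?thesis
      using that[of "Suc (Suc N)"] by simp
  qed (use that in blast)
  then obtain r' where "r' \<in> {1..5}" "\<bar>r' - r\<bar> < \<epsilon>" "(quad_map ^^ n) r' = s"
    using N s by (meson Suc_leD)
  then show ?thesis
    using that n by (metis One_nat_def Suc_leD Suc_le_mono le0 order_trans)
qed

lemma transitive_annulus:
  assumes U1: "openin (top_of_set annulus) U1" "U1 \<noteq> {}"
    and U2: "openin (top_of_set annulus) U2" "U2 \<noteq> {}"
  shows "\<exists>q\<in>U1. \<exists>j0 t0 i. 0 < t0 \<and> (\<exists>z\<in>U2. Gam rot_system i q j0 t0 = Some z)"
proof -
  obtain q where q: "q \<in> U1" "q \<in> annulus"
    using U1 openin_imp_subset by blast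
  obtain i r a where qa: "r \<in> {1..5}" "0 \<le> a" "a \<le> pi" "q = polar i r a"
    using annulus_polar[OF q(2)] by metis
  obtain \<epsilon> where \<epsilon>: "\<epsilon> > 0" "ball q \<epsilon> \<inter> annulus \<subseteq> U1"
    using U1(1) q(1) by (meson openin_contains_ball)
  obtain z where z: "z \<in> U2" "z \<in> annulus"
    using U2 openin_imp_subset by blast
  obtain j s b where zb: "s \<in> {1..5}" "0 \<le> b" "b \<le> pi" "z = polar j s b"
    using annulus_polar[OF z(2)] by metis
  \<comment> \<open>Positive times are required, so a target at the angle \<open>0\<close> is moved a little along its arc.\<close>
  obtain b' where b': "0 < b'" "b' \<le> pi" "polar j s b' \<in> U2"
  proof (cases "b = 0")
    case False
    then show ?thesis
      using that[of b] zb z by simp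
  next
    case True
    obtain \<delta> where \<delta>: "\<delta> > 0" "ball z \<delta> \<inter> annulus \<subseteq> U2"
      using U2(1) z(1) by (meson openin_contains_ball)
    have "isCont (polar j s) 0"
      unfolding polar_def by (intro continuous_intros)
    then obtain \<eta> where \<eta>: "\<eta> > 0" "\<And>t. dist t 0 < \<eta> \<Longrightarrow> dist (polar j s t) (polar j s 0) < \<delta>"
      using \<delta>(1) unfolding continuous_at_eps_delta by blast
    define t where "t = min (\<eta> / 2) pi"
    have t: "0 < t" "t \<le> pi" "t < \<eta>"
      using \<eta>(1) pi_gt_zero by (auto simp: t_def)
    have "dist z (polar j s t) < \<delta>"
      using \<eta>(2)[of t] t True zb(4) by (simp add: dist_commute)
    then have "polar j s t \<in> U2"
      using \<delta>(2) polar_in_annulus[OF zb(1)] by auto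
    then show ?thesis
      using that t by blast
  qed
  obtain r' n where r': "r' \<in> {1..5}" "\<bar>r' - r\<bar> < \<epsilon>" "n \<ge> 1" "(quad_map ^^ n) r' = s"
      "(other ^^ n) i = j"
    using qa(1) \<epsilon>(1) zb(1) by (rule polar_transitive)
  have "dist q (polar i r' a) < \<epsilon>"
    using r'(2) by (simp add: qa(4) dist_norm polar_diff)
  then have "polar i r' a \<in> U1"
    using \<epsilon>(2) polar_in_annulus[OF r'(1)] by auto
  moreover have "Gam rot_system i (polar i r' a) n b' = Some (polar j s b')"
    using Gam_polar_Suc[OF r'(1) qa(2,3), of b' n i] b' r' by simp
  ultimately show ?thesis
    using b' by blast
qed

lemma sensitive_annulus:
  assumes "q1 \<in> annulus" "\<epsilon> > 0"
  shows "\<exists>q2\<in>ball q1 \<epsilon> \<inter> annulus. \<exists>j0 t0 i0 z1 z2. 0 < t0 \<and>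
    Gam rot_system i0 q1 j0 t0 = Some z1 \<and> Gam rot_system i0 q2 j0 t0 = Some z2 \<and>
    norm (z1 - z2) > 1"
proof -
  obtain i r a where qa: "r \<in> {1..5}" "0 \<le> a" "a \<le> pi" "q1 = polar i r a"
    using annulus_polar[OF assms(1)] by metis
  obtain N where N: "\<forall>n\<ge>N. \<forall>s\<in>{1..5}. \<exists>r'\<in>{1..5}. \<bar>r' - r\<bar> < \<epsilon> \<and> (quad_map ^^ n) r' = s"
    using quad_locally_onto[OF qa(1) assms(2)] by blast
  define s1 where "s1 = (quad_map ^^ Suc N) r"
  define s2 :: real where "s2 = (if s1 \<le> 3 then 5 else 1)"
  have "s2 \<in> {1..5}"
    by (simp add: s2_def)
  then obtain r' where r': "r' \<in> {1..5}" "\<bar>r' - r\<bar> < \<epsilon>" "(quad_map ^^ Suc N) r' = s2"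
    using N le_SucI by blast
  have "polar i r' a \<in> ball q1 \<epsilon> \<inter> annulus"
    using r'(2) polar_in_annulus[OF r'(1)] by (simp add: qa(4) dist_norm polar_diff)
  moreover have "Gam rot_system i q1 (Suc N) pi = Some (0, - s1)"
    using Gam_polar_Suc[OF qa(1-3), of pi "Suc N" i] by (simp add: qa(4) s1_def)
  moreover have "Gam rot_system i (polar i r' a) (Suc N) pi = Some (0, - s2)"
    using Gam_polar_Suc[OF r'(1) qa(2,3), of pi "Suc N" i] r'(3) by simp
  moreover have "norm ((0 :: real, - s1) - (0, - s2)) > 1"
    by (simp add: norm_Pair s2_def)
  ultimately show ?thesis
    using pi_gt_zero by blast
qed

lemma chaotic_rot_system: "chaotic rot_system"
  unfolding chaotic_def
proof (intro exI[of _ annulus] conjI)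
  have "(0, 1) \<in> annulus"
    by (simp add: annulus_def norm_Pair)
  then show "annulus \<noteq> {}"
    by blast
  show "\<exists>\<beta>>0. \<forall>q1\<in>annulus. \<forall>\<epsilon>>0. \<exists>q2\<in>ball q1 \<epsilon> \<inter> annulus. \<exists>j0 t0 i0 z1 z2. 0 < t0 \<and>
    Gam rot_system i0 q1 j0 t0 = Some z1 \<and> Gam rot_system i0 q2 j0 t0 = Some z2 \<and>
    norm (z1 - z2) > \<beta>"
    using sensitive_annulus by (intro exI[of _ 1]) auto
qed (use compact_annulus positive_invariant_annulus periodic_points_dense transitive_annulus
      in auto)

theorem theorem5: "\<exists>X \<in> hybrid_class 2. chaotic X"
  using rot_system_in_class chaotic_rot_system by blast

end
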